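(* The set $\mathcal{L}$ of all polynomial knots (in $\mathbb{R}^n$ for some $n\geq1$), equipped with any one of the topologies $\mathcal{T}_b$, $\mathcal{T}_p$, $\mathcal{T}_r$ (for any real $r\geq1$) and $\mathcal{T}_\infty$, is contractible.
   Context: $\mathbb{Z}^+$ is the set of positive integers, $\mathbb{N}$ the set of nonnegative integers, $\Lambda=\mathbb{Z}^+\times\mathbb{N}$, and $\mathbb{R}^\Lambda$ is the set of all families $(\phi_{ij})_{(i,j)\in\Lambda}$ of real numbers. A polynomial knot in $\mathbb{R}^n$ is a smooth embedding $\mathbb{R}\hookrightarrow\mathbb{R}^n$ whose component functions are real polynomials; equivalently (the paper's formulation), a map $\phi=(\phi_1,\ldots,\phi_n):\mathbb{R}\to\mathbb{R}^n$ such that each $\phi_i\in\mathbb{R}[t]$, $\phi(s)\neq\phi(t)$ for $s\neq t$, and $\phi'(t)\neq 0$ for all $t\in\mathbb{R}$. A polynomial knot $\phi$ in $\mathbb{R}^n$ is identified with the element $(\phi_{ij})_{i,j}\in\mathbb{R}^\Lambda$, where $\phi_{ij}$ is the coefficient of $t^j$ in the $i$-th component of $\phi$ for $i\leq n$, and $\phi_{ij}=0$ for $i>n$. Under this identification, $\mathcal{L}^n\subseteq\mathbb{R}^\Lambda$ is the set of all polynomial knots in $\mathbb{R}^n$, and $\mathcal{L}=\bigcup_{n\in\mathbb{Z}^+}\mathcal{L}^n\subseteq\mathbb{R}^\Lambda$. Topologies on $\mathcal{L}$: $\mathcal{T}_b$ is the subspace topology inherited from the box topology of $\mathbb{R}^\Lambda$;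 $\mathcal{T}_p$ is the subspace topology inherited from the product topology of $\mathbb{R}^\Lambda$; for real $r\geq1$, $\mathcal{T}_r$ is the topology induced by the metric $d_r(\phi,\psi)=\left(\sum_{i,j}|\phi_{ij}-\psi_{ij}|^r\right)^{1/r}$; $\mathcal{T}_\infty$ is the topology induced by the metric $d_\infty(\phi,\psi)=\sup_{i,j}|\phi_{ij}-\psi_{ij}|$. *)

theory Defs
  imports "HOL-Analysis.Analysis" "HOL-Computational_Algebra.Polynomial"
begin

definition Lam :: "(nat \<times> nat) set" where
  "Lam = {1..} \<times> UNIV"

text \<open>
  The space of all real families over \<open>Lam\<close> is the extensional product \<open>Lam \<rightarrow>\<^sub>E UNIV\<close>, which is
  the carrier that the library uses for product topologies. A map into \<open>n\<close>-space is likewise an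
  extensional family over \<open>{1..n}\<close>; only the components \<open>\<phi> i\<close> with \<open>i \<in> {1..n}\<close> matter below.
\<close>

definition poly_map :: "nat \<Rightarrow> (nat \<Rightarrow> real poly) \<Rightarrow> real \<Rightarrow> nat \<Rightarrow> real" where
  "poly_map n \<phi> t = (\<lambda>i\<in>{1..n}. poly (\<phi> i) t)"

definition polynomial_knot :: "nat \<Rightarrow> (nat \<Rightarrow> real poly) \<Rightarrow> bool" where
  "polynomial_knot n \<phi> \<longleftrightarrow>
     (\<forall>s t. s \<noteq> t \<longrightarrow> poly_map n \<phi> s \<noteq> poly_map n \<phi> t) \<and>
     (\<forall>t. poly_map n (\<lambda>i. pderiv (\<phi> i)) t \<noteq> (\<lambda>i\<in>{1..n}. 0))"

definition coeff_family :: "nat \<Rightarrow> (nat \<Rightarrow> real poly) \<Rightarrow> nat \<times> nat \<Rightarrow> real" where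
  "coeff_family n \<phi> = (\<lambda>(i, j)\<in>Lam. if i \<le> n then coeff (\<phi> i) j else 0)"

definition knots_in :: "nat \<Rightarrow> (nat \<times> nat \<Rightarrow> real) set" where
  "knots_in n = {coeff_family n \<phi> | \<phi>. polynomial_knot n \<phi>}"

definition knots :: "(nat \<times> nat \<Rightarrow> real) set" where
  "knots = (\<Union>n\<in>{1..}. knots_in n)"

definition box_topology :: "('i \<Rightarrow> 'a topology) \<Rightarrow> 'i set \<Rightarrow> ('i \<Rightarrow> 'a) topology" where
  "box_topology T I = topology_generated_by {(\<Pi>\<^sub>E i\<in>I. X i) | X. \<forall>i. openin (T i) (X i)}"

definition knots_box :: "(nat \<times> nat \<Rightarrow> real) topology" where
  "knots_box = subtopology (box_topology (\<lambda>_. euclideanreal) Lam) knots"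

definition knots_prod :: "(nat \<times> nat \<Rightarrow> real) topology" where
  "knots_prod = subtopology (product_topology (\<lambda>_. euclideanreal) Lam) knots"

definition dist_r :: "real \<Rightarrow> (nat \<times> nat \<Rightarrow> real) \<Rightarrow> (nat \<times> nat \<Rightarrow> real) \<Rightarrow> real" where
  "dist_r r \<phi> \<psi> = (\<Sum>\<^sub>\<infinity>p\<in>Lam. \<bar>\<phi> p - \<psi> p\<bar> powr r) powr (1 / r)"

text \<open>
  The locale \<open>Metric_space\<close> demands nonnegativity of the distance also outside its carrier, where
  the real supremum of an unbounded set would be unspecified; hence the guard.
\<close>

definition dist_sup :: "(nat \<times> nat \<Rightarrow> real) \<Rightarrow> (nat \<times> nat \<Rightarrow> real) \<Rightarrow> real" where
  "dist_sup \<phi> \<psi> =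
     (if \<phi> \<in> knots \<and> \<psi> \<in> knots then SUP p\<in>Lam. \<bar>\<phi> p - \<psi> p\<bar> else 0)"

definition knots_r :: "real \<Rightarrow> (nat \<times> nat \<Rightarrow> real) topology" where
  "knots_r r = Metric_space.mtopology knots (dist_r r)"

definition knots_sup :: "(nat \<times> nat \<Rightarrow> real) topology" where
  "knots_sup = Metric_space.mtopology knots dist_sup"

text \<open>Both distances are indeed metrics, so that \<open>Metric_space.mtopology\<close> is meaningful.\<close>

lemma Lam_ne: "Lam \<noteq> {}"
  by (auto simp: Lam_def)

lemma knots_ext: "\<phi> \<in> knots \<Longrightarrow> p \<notin> Lam \<Longrightarrow> \<phi> p = undefined"
  by (auto simp: knots_def knots_in_def coeff_family_def)

lemma knots_finite_support:
  assumes "\<phi> \<in> knots"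
  shows "finite {p \<in> Lam. \<phi> p \<noteq> 0}"
proof -
  obtain n q where q: "\<phi> = coeff_family n q"
    using assms by (auto simp: knots_def knots_in_def)
  have "{p \<in> Lam. \<phi> p \<noteq> 0} \<subseteq> (SIGMA i:{..n}. {..degree (q i)})"
    by (auto simp: q coeff_family_def le_degree split: if_splits)
  thus ?thesis by (rule finite_subset) auto
qed

lemma knots_diff_support:
  assumes "\<phi> \<in> knots" "\<psi> \<in> knots"
  shows "finite {p \<in> Lam. \<phi> p \<noteq> \<psi> p}"
  by (rule finite_subset[OF _ finite_UnI[OF knots_finite_support[OF assms(1)]
        knots_finite_support[OF assms(2)]]]) auto

lemma knots_eqI:
  assumes "\<phi> \<in> knots" "\<psi> \<in> knots" "\<And>p. p \<in> Lam \<Longrightarrow> \<phi> p = \<psi> p"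
  shows "\<phi> = \<psi>"
  using assms knots_ext by (metis ext)

lemma dist_sup_bdd:
  assumes "\<phi> \<in> knots" "\<psi> \<in> knots"
  shows "bdd_above ((\<lambda>p. \<bar>\<phi> p - \<psi> p\<bar>) ` Lam)"
proof -
  have "(\<lambda>p. \<bar>\<phi> p - \<psi> p\<bar>) ` Lam \<subseteq> insert 0 ((\<lambda>p. \<bar>\<phi> p - \<psi> p\<bar>) ` {p \<in> Lam. \<phi> p \<noteq> \<psi> p})"
    by auto
  hence "finite ((\<lambda>p. \<bar>\<phi> p - \<psi> p\<bar>) ` Lam)"
    by (rule finite_subset) (simp add: knots_diff_support[OF assms])
  thus ?thesis by simp
qed

lemma dist_sup_ge:
  assumes "\<phi> \<in> knots" "\<psi> \<in> knots" "p \<in> Lam"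
  shows "\<bar>\<phi> p - \<psi> p\<bar> \<le> dist_sup \<phi> \<psi>"
  using assms cSUP_upper[OF assms(3) dist_sup_bdd[OF assms(1,2)]] by (simp add: dist_sup_def)

lemma dist_sup_nonneg: "0 \<le> dist_sup \<phi> \<psi>"
proof (cases "\<phi> \<in> knots \<and> \<psi> \<in> knots")
  case True
  obtain p where "p \<in> Lam" using Lam_ne by auto
  with True dist_sup_ge[of \<phi> \<psi> p] show ?thesis by linarith
qed (auto simp: dist_sup_def)

lemma Metric_space_dist_sup: "Metric_space knots dist_sup"
proof
  fix x y
  show "0 \<le> dist_sup x y" by (rule dist_sup_nonneg)
  show "dist_sup x y = dist_sup y x" by (simp add: dist_sup_def abs_minus_commute)
next
  fix x y assume "x \<in> knots" "y \<in> knots"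
  moreover have "(SUP p\<in>Lam. (0::real)) = 0" using Lam_ne by simp
  ultimately show "dist_sup x y = 0 \<longleftrightarrow> x = y"
    using dist_sup_ge[of x y] knots_eqI[of x y] by (fastforce simp: dist_sup_def)
next
  fix x y z assume a: "x \<in> knots" "y \<in> knots" "z \<in> knots"
  have "(SUP p\<in>Lam. \<bar>x p - z p\<bar>) \<le> dist_sup x y + dist_sup y z"
  proof (rule cSUP_least[OF Lam_ne])
    fix p assume "p \<in> Lam"
    thus "\<bar>x p - z p\<bar> \<le> dist_sup x y + dist_sup y z"
      using dist_sup_ge[of x y p] dist_sup_ge[of y z p] a by linarith
  qed
  thus "dist_sup x z \<le> dist_sup x y + dist_sup y z" using a by (simp add: dist_sup_def[of x z])
qed

lemma powr_convex_nonneg: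
  fixes x y u r :: real
  assumes "r \<ge> 1" "x \<ge> 0" "y \<ge> 0" "0 < u" "u < 1"
  shows "(u * x + (1 - u) * y) powr r \<le> u * x powr r + (1 - u) * y powr r"
proof -
  have small: "v powr r \<le> v" if "0 < v" "v < 1" for v :: real
    using powr_mono'[of 1 r v] that assms by simp
  consider "x = 0" | "y = 0" | "x > 0" "y > 0" using assms by linarith
  thus ?thesis
  proof cases
    case 1
    thus ?thesis using assms small[of "1 - u"] by (simp add: powr_mult mult_right_mono)
  next
    case 2
    thus ?thesis using assms small[of u] by (simp add: powr_mult mult_right_mono)
  next
    case 3
    thus ?thesis using convex_onD[OF powr_convex[OF assms(1)], of "1 - u" x y] assms by simp
  qed
qed

lemma Minkowski_finite:
  fixes a b :: "'a \<Rightarrow> real"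
  assumes F: "finite F" and r: "r \<ge> 1" and a: "\<And>p. a p \<ge> 0" and b: "\<And>p. b p \<ge> 0"
  shows "(\<Sum>p\<in>F. (a p + b p) powr r) powr (1/r)
           \<le> (\<Sum>p\<in>F. a p powr r) powr (1/r) + (\<Sum>p\<in>F. b p powr r) powr (1/r)"
proof -
  define A where "A = (\<Sum>p\<in>F. a p powr r) powr (1/r)"
  define B where "B = (\<Sum>p\<in>F. b p powr r) powr (1/r)"
  have Ar: "A powr r = (\<Sum>p\<in>F. a p powr r)" and Br: "B powr r = (\<Sum>p\<in>F. b p powr r)"
    using r by (simp_all add: A_def B_def powr_powr sum_nonneg)
  have "A \<ge> 0" "B \<ge> 0" by (simp_all add: A_def B_def)
  then consider "A = 0" | "B = 0" | "A > 0" "B > 0" by linarith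
  hence "(\<Sum>p\<in>F. (a p + b p) powr r) powr (1/r) \<le> A + B"
  proof cases
    case 1
    hence "\<forall>p\<in>F. a p = 0" using Ar F by (simp add: sum_nonneg_eq_0_iff)
    thus ?thesis using \<open>A \<ge> 0\<close> by (simp add: B_def)
  next
    case 2
    hence "\<forall>p\<in>F. b p = 0" using Br F by (simp add: sum_nonneg_eq_0_iff)
    thus ?thesis using \<open>B \<ge> 0\<close> by (simp add: A_def)
  next
    case 3
    define u where "u = A / (A + B)"
    have u: "0 < u" "u < 1" "1 - u = B / (A + B)" using 3 by (auto simp: u_def field_simps)
    have *: "(a p + b p) powr r
        \<le> (A + B) powr r * (u * (a p powr r / A powr r) + (1 - u) * (b p powr r / B powr r))" for p
    proof -
      have "a p + b p = (A + B) * (u * (a p / A) + (1 - u) * (b p / B))"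
        using 3 unfolding u(3) by (simp add: u_def add_divide_distrib[symmetric])
      hence "(a p + b p) powr r = (A + B) powr r * (u * (a p / A) + (1 - u) * (b p / B)) powr r"
        using 3 u a b by (simp add: powr_mult)
      also have "\<dots> \<le> (A + B) powr r * (u * (a p / A) powr r + (1 - u) * (b p / B) powr r)"
        using powr_convex_nonneg[OF r, of "a p / A" "b p / B" u] 3 u a b
        by (intro mult_left_mono) auto
      finally show ?thesis using 3 a b by (simp add: powr_divide)
    qed
    have "(\<Sum>p\<in>F. (a p + b p) powr r)
        \<le> (\<Sum>p\<in>F. (A + B) powr r * (u * (a p powr r / A powr r) + (1 - u) * (b p powr r / B powr r)))"
      by (intro sum_mono *)
    also have "\<dots> = (A + B) powr r *
        (u * ((\<Sum>p\<in>F. a p powr r) / A powr r) + (1 - u) * ((\<Sum>p\<in>F. b p powr r) / B powr r))"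
      by (simp flip: sum_distrib_left add: sum_divide_distrib sum.distrib)
        (simp add: sum_distrib_left)
    also have "\<dots> = (A + B) powr r"
      using 3 unfolding Ar[symmetric] Br[symmetric] by simp
    finally have "(\<Sum>p\<in>F. (a p + b p) powr r) powr (1/r) \<le> ((A + B) powr r) powr (1/r)"
      using r by (intro powr_mono2) (auto intro: sum_nonneg)
    thus ?thesis using 3 r by (simp add: powr_powr)
  qed
  thus ?thesis by (simp add: A_def B_def)
qed

lemma dist_r_finite:
  assumes "finite F" "F \<subseteq> Lam" "{p \<in> Lam. \<phi> p \<noteq> \<psi> p} \<subseteq> F"
  shows "dist_r r \<phi> \<psi> = (\<Sum>p\<in>F. \<bar>\<phi> p - \<psi> p\<bar> powr r) powr (1/r)"
proof -
  have "(\<Sum>\<^sub>\<infinity>p\<in>Lam. \<bar>\<phi> p - \<psi> p\<bar> powr r) = (\<Sum>\<^sub>\<infinity>p\<in>F. \<bar>\<phi> p - \<psi> p\<bar> powr r)"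
    using assms by (intro infsum_cong_neutral) auto
  thus ?thesis using assms(1) by (simp add: dist_r_def)
qed

lemma Metric_space_dist_r:
  assumes r: "r \<ge> 1"
  shows "Metric_space knots (dist_r r)"
proof
  fix x y
  show "0 \<le> dist_r r x y" by (simp add: dist_r_def)
  show "dist_r r x y = dist_r r y x" by (simp add: dist_r_def abs_minus_commute)
next
  fix x y assume a: "x \<in> knots" "y \<in> knots"
  let ?F = "{p \<in> Lam. x p \<noteq> y p}"
  have F: "finite ?F" by (rule knots_diff_support[OF a])
  have "dist_r r x y = 0 \<longleftrightarrow> (\<forall>p\<in>?F. \<bar>x p - y p\<bar> powr r = 0)"
    using F by (subst dist_r_finite[OF F]) (auto simp: sum_nonneg_eq_0_iff)
  also have "\<dots> \<longleftrightarrow> x = y" using knots_eqI[OF a] by auto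
  finally show "dist_r r x y = 0 \<longleftrightarrow> x = y" .
next
  fix x y z assume a: "x \<in> knots" "y \<in> knots" "z \<in> knots"
  let ?F = "{p \<in> Lam. x p \<noteq> y p} \<union> {p \<in> Lam. y p \<noteq> z p}"
  have F: "finite ?F" using knots_diff_support a by simp
  have "dist_r r x z = (\<Sum>p\<in>?F. \<bar>x p - z p\<bar> powr r) powr (1/r)"
    by (rule dist_r_finite[OF F]) auto
  also have "\<dots> \<le> (\<Sum>p\<in>?F. (\<bar>x p - y p\<bar> + \<bar>y p - z p\<bar>) powr r) powr (1/r)"
    using r by (intro powr_mono2 sum_mono sum_nonneg) auto
  also have "\<dots> \<le> (\<Sum>p\<in>?F. \<bar>x p - y p\<bar> powr r) powr (1/r) + (\<Sum>p\<in>?F. \<bar>y p - z p\<bar> powr r) powr (1/r)"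
    by (rule Minkowski_finite[OF F r]) auto
  also have "\<dots> = dist_r r x y + dist_r r y z"
    by (subst (1 2) dist_r_finite[OF F]) auto
  finally show "dist_r r x z \<le> dist_r r x y + dist_r r y z" .
qed

end

theory Submission
  imports Defs
begin

text \<open>
  Shifting the components, \<open>(\<phi>\<^sub>1, \<phi>\<^sub>2, \<dots>) \<mapsto> (0, \<phi>\<^sub>1, \<phi>\<^sub>2, \<dots>)\<close>, is the endpoint of the family of
  linear maps \<open>(1 - u) \<cdot> id + u \<cdot> shift\<close>, all of which are injective, so the straight segment from
  a knot to its shift consists of knots. The segment from the shift to the line \<open>(t, 0, 0, \<dots>)\<close>
  consists of knots too, since its first component is \<open>u t\<close>. It remains to see that these two
  straight-line homotopies are continuous. Each topology is generated by a family of seminorms on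
  the finitely supported families: the box topology by all suprema with positive weights, the
  product topology by those with finitely supported weights, and the metric topologies by one norm.
\<close>

section \<open>Segments of knots\<close>

text \<open>
  Linear functionals that capture injectivity and nonvanishing derivative at once: each of them
  must be nonzero on some component of a knot.
\<close>

definition embedding_functionals :: "(real poly \<Rightarrow> real) set" where
  "embedding_functionals =
     {\<lambda>p. poly p s - poly p t | s t. s \<noteq> t} \<union> {\<lambda>p. poly (pderiv p) t | t. True}"

definition embedded :: "(nat \<Rightarrow> real poly) \<Rightarrow> bool" where
  "embedded q \<longleftrightarrow> (\<forall>L\<in>embedding_functionals. \<exists>i\<ge>1. L (q i) \<noteq> 0)"

text \<open>Unlike \<open>coeff_family\<close>, no dimension appears: a knot becomes a sequence of
  polynomials that vanishes from some index on, so constructions on knots need not track how the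
  dimension changes.\<close>

definition family :: "(nat \<Rightarrow> real poly) \<Rightarrow> nat \<times> nat \<Rightarrow> real" where
  "family q = (\<lambda>(i, j)\<in>Lam. coeff (q i) j)"

lemma embedding_functional_linear:
  assumes "L \<in> embedding_functionals"
  shows "L (smult a p + smult b q) = a * L p + b * L q"
  using assms
  by (auto simp: embedding_functionals_def pderiv_add pderiv_smult algebra_simps)

lemma embedding_functional_0:
  "L \<in> embedding_functionals \<Longrightarrow> L 0 = 0"
  by (auto simp: embedding_functionals_def)

lemma embedding_functional_X:
  "L \<in> embedding_functionals \<Longrightarrow> L [:0, 1:] \<noteq> 0"
  by (auto simp: embedding_functionals_def pderiv_pCons)

lemma ball_embedding_functionals:
  "(\<forall>L\<in>embedding_functionals. P L) \<longleftrightarrow>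
     (\<forall>s t. s \<noteq> t \<longrightarrow> P (\<lambda>p. poly p s - poly p t)) \<and> (\<forall>t. P (\<lambda>p. poly (pderiv p) t))"
  unfolding embedding_functionals_def by blast

text \<open>Two restricted maps differ iff some difference of components is nonzero. Applied to
  values at distinct points and to the derivative against zero, this produces exactly the two kinds
  of functionals.\<close>

lemma polynomial_knot_iff:
  "polynomial_knot n q \<longleftrightarrow> (\<forall>L\<in>embedding_functionals. \<exists>i\<in>{1..n}. L (q i) \<noteq> 0)"
proof -
  have *: "restrict f {1..n} \<noteq> restrict g {1..n} \<longleftrightarrow> (\<exists>i\<in>{1..n}. f i - g i \<noteq> 0)"
    for f g :: "nat \<Rightarrow> real"
    unfolding right_minus_eq by (metis restrict_apply' restrict_ext)
  have "polynomial_knot n q \<longleftrightarrow>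
      (\<forall>s t. s \<noteq> t \<longrightarrow> (\<exists>i\<in>{1..n}. poly (q i) s - poly (q i) t \<noteq> 0)) \<and>
      (\<forall>t. \<exists>i\<in>{1..n}. poly (pderiv (q i)) t - 0 \<noteq> 0)"
    unfolding polynomial_knot_def poly_map_def * ..
  thus ?thesis by (simp only: ball_embedding_functionals diff_0_right)
qed

text \<open>The union over all dimensions is absorbed by finite support. Zero components are
  harmless because every functional vanishes on the zero polynomial, so a witness of nonvanishing
  lies among the finitely many nonzero components.\<close>

lemma knots_iff:
  "\<phi> \<in> knots \<longleftrightarrow> (\<exists>q. finite {i. q i \<noteq> 0} \<and> embedded q \<and> \<phi> = family q)"
proof
  assume "\<phi> \<in> knots"
  then obtain n q where q: "polynomial_knot n q" "\<phi> = coeff_family n q"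
    by (auto simp: knots_def knots_in_def)
  \<comment> \<open>Components of \<open>q\<close> beyond \<open>n\<close> are arbitrary; cutting
    them off gives finite support without changing the family.\<close>
  define q' where "q' = (\<lambda>i. if i \<le> n then q i else 0)"
  have "finite {i. q' i \<noteq> 0}" by (rule finite_subset[of _ "{..n}"]) (auto simp: q'_def)
  moreover have "embedded q'"
    using q(1) unfolding embedded_def polynomial_knot_iff q'_def by fastforce
  moreover have "\<phi> = family q'"
    unfolding q(2) coeff_family_def family_def q'_def by (auto intro!: restrict_ext)
  ultimately show "\<exists>q. finite {i. q i \<noteq> 0} \<and> embedded q \<and> \<phi> = family q" by blast
next
  assume "\<exists>q. finite {i. q i \<noteq> 0} \<and> embedded q \<and> \<phi> = family q"
  then obtain q where q: "finite {i. q i \<noteq> 0}" "embedded q" "\<phi> = family q" by blast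
  then obtain m where "\<forall>i\<in>{i. q i \<noteq> 0}. i \<le> m" using finite_nat_set_iff_bounded_le by auto
  hence m: "q i = 0" if "i > Suc m" for i
    using that by (metis (mono_tags, lifting) Suc_lessD leD mem_Collect_eq)
  \<comment> \<open>\<open>Suc m\<close> is a positive dimension without further argument, as
    \<open>knots\<close> demands.\<close>
  have "polynomial_knot (Suc m) q"
    unfolding polynomial_knot_iff
  proof
    fix L assume L: "L \<in> embedding_functionals"
    then obtain i where i: "i \<ge> 1" "L (q i) \<noteq> 0" using q(2) by (auto simp: embedded_def)
    hence "i \<le> Suc m" using m[of i] embedding_functional_0[OF L] by (metis not_le)
    thus "\<exists>i\<in>{1..Suc m}. L (q i) \<noteq> 0" using i by auto
  qed
  moreover have "\<phi> = coeff_family (Suc m) q"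
    unfolding q(3) coeff_family_def family_def using m by (auto intro!: restrict_ext)
  ultimately show "\<phi> \<in> knots" by (auto simp: knots_def knots_in_def)
qed

lemma family_in_knots: "finite {i. q i \<noteq> 0} \<Longrightarrow> embedded q \<Longrightarrow> family q \<in> knots"
  unfolding knots_iff by blast

section \<open>Segments, the shift and the straight line\<close>

definition segment :: "real \<Rightarrow> (nat \<times> nat \<Rightarrow> real) \<Rightarrow> (nat \<times> nat \<Rightarrow> real) \<Rightarrow> nat \<times> nat \<Rightarrow> real" where
  "segment u \<phi> \<psi> = (\<lambda>p\<in>Lam. (1 - u) * \<phi> p + u * \<psi> p)"

definition shift :: "(nat \<times> nat \<Rightarrow> real) \<Rightarrow> nat \<times> nat \<Rightarrow> real" where
  "shift \<phi> = (\<lambda>(i, j)\<in>Lam. if i = 1 then 0 else \<phi> (i - 1, j))"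

text \<open>The test \<open>i <= 1\<close> also clears index 0, which lies outside
  \<open>Lam\<close>; hence the support of the result is contained in the \<open>Suc\<close>-image
  of the support of \<open>q\<close>.\<close>

definition shift_poly :: "(nat \<Rightarrow> real poly) \<Rightarrow> nat \<Rightarrow> real poly" where
  "shift_poly q = (\<lambda>i. if i \<le> 1 then 0 else q (i - 1))"

definition line_poly :: "nat \<Rightarrow> real poly" where
  "line_poly = (\<lambda>i. if i = 1 then [:0, 1:] else 0)"

lemma shift_family: "shift (family q) = family (shift_poly q)"
  by (auto simp: shift_def family_def shift_poly_def Lam_def fun_eq_iff)

lemma segment_family:
  "segment u (family q) (family q') = family (\<lambda>i. smult (1 - u) (q i) + smult u (q' i))"
  by (auto simp: segment_def family_def fun_eq_iff)

lemma segment_0: "\<phi> \<in> knots \<Longrightarrow> segment 0 \<phi> \<psi> = \<phi>"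
  by (auto simp: segment_def fun_eq_iff knots_ext)

lemma segment_1: "\<psi> \<in> knots \<Longrightarrow> segment 1 \<phi> \<psi> = \<psi>"
  by (auto simp: segment_def fun_eq_iff knots_ext)

lemma finite_shift_poly: "finite {i. q i \<noteq> 0} \<Longrightarrow> finite {i. shift_poly q i \<noteq> 0}"
proof (rule finite_subset[of _ "Suc ` {i. q i \<noteq> 0}"])
  show "{i. shift_poly q i \<noteq> 0} \<subseteq> Suc ` {i. q i \<noteq> 0}"
  proof
    fix i assume "i \<in> {i. shift_poly q i \<noteq> 0}"
    thus "i \<in> Suc ` {i. q i \<noteq> 0}"
      by (intro image_eqI[of _ _ "i - 1"]) (auto simp: shift_poly_def split: if_splits)
  qed
qed simp

lemma finite_line_poly: "finite {i. line_poly i \<noteq> 0}"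
  by (rule finite_subset[of _ "{1}"]) (auto simp: line_poly_def)

lemma finite_segment_poly:
  assumes "finite {i. q i \<noteq> 0}" "finite {i. q' i \<noteq> 0}"
  shows "finite {i. smult a (q i) + smult b (q' i) \<noteq> (0 :: real poly)}"
  by (rule finite_subset[OF _ finite_UnI[OF assms]]) auto

text \<open>Injectivity of \<open>(1 - u) \<cdot> id + u \<cdot> shift\<close>, on sequences indexed from 1.\<close>

lemma segment_shift_injective:
  fixes d :: "nat \<Rightarrow> real"
  assumes "\<And>i. i \<ge> 1 \<Longrightarrow> (1 - u) * d i + u * (if i \<le> 1 then 0 else d (i - 1)) = 0"
    and "i \<ge> 1"
  shows "d i = 0"
proof (cases "u = 1")
  \<comment> \<open>The map is then the pure shift, and the equation at index \<open>Suc i\<close>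
    reads off \<open>d i\<close>.\<close>
  case True
  thus ?thesis using assms(1)[of "Suc i"] \<open>i \<ge> 1\<close> by simp
next
  \<comment> \<open>The system is lower triangular with nonzero diagonal entries
    \<open>1 - u\<close>, so it is solved upwards from index 1.\<close>
  case False
  show ?thesis using \<open>i \<ge> 1\<close>
  proof (induction i rule: dec_induct)
    case base
    thus ?case using assms(1)[of 1] False by simp
  next
    case (step n)
    thus ?case using assms(1)[of "Suc n"] False by simp
  qed
qed

text \<open>A functional \<open>L\<close> commutes with the linear combination, so its values on the
  segment arise from the sequence of all \<open>L (q i)\<close> by an injective linear map. If they
  all vanished, \<open>L\<close> would vanish on every component of \<open>q\<close>.\<close>

lemma embedded_segment_shift:
  assumes "embedded q"
  shows "embedded (\<lambda>i. smult (1 - u) (q i) + smult u (shift_poly q i))"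
  unfolding embedded_def
proof
  fix L assume L: "L \<in> embedding_functionals"
  have *: "L (shift_poly q i) = (if i \<le> 1 then 0 else L (q (i - 1)))" for i
    using embedding_functional_0[OF L] by (simp add: shift_poly_def)
  show "\<exists>i\<ge>1. L (smult (1 - u) (q i) + smult u (shift_poly q i)) \<noteq> 0"
    using segment_shift_injective[of u "\<lambda>i. L (q i)"] assms L
    unfolding embedding_functional_linear[OF L] * embedded_def by blast
qed

lemma embedded_shift: "embedded q \<Longrightarrow> embedded (shift_poly q)"
  using embedded_segment_shift[of q 1] by simp

text \<open>For nonzero \<open>u\<close> the first component is \<open>u\<close> times the identity
  polynomial, on which no functional vanishes; for \<open>u = 0\<close> only the shifted knot
  remains.\<close>

lemma embedded_segment_line:
  assumes "embedded q"
  shows "embedded (\<lambda>i. smult (1 - u) (shift_poly q i) + smult u (line_poly i))"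
proof (cases "u = 0")
  case True
  thus ?thesis using embedded_shift[OF assms] by simp
next
  case False
  show ?thesis
    unfolding embedded_def
  proof
    fix L assume L: "L \<in> embedding_functionals"
    have "L (smult (1 - u) (shift_poly q 1) + smult u (line_poly 1)) \<noteq> 0"
      unfolding embedding_functional_linear[OF L]
      using False embedding_functional_X[OF L] embedding_functional_0[OF L]
      by (simp add: shift_poly_def line_poly_def)
    thus "\<exists>i\<ge>1. L (smult (1 - u) (shift_poly q i) + smult u (line_poly i)) \<noteq> 0" by blast
  qed
qed

lemma line_in_knots: "family line_poly \<in> knots"
proof -
  have "embedded line_poly"
    using embedding_functional_X by (auto simp: embedded_def line_poly_def)
  thus ?thesis by (intro family_in_knots finite_line_poly)
qed

lemma shift_in_knots: "\<phi> \<in> knots \<Longrightarrow> shift \<phi> \<in> knots"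
  unfolding knots_iff by (metis shift_family finite_shift_poly embedded_shift)

lemma segment_shift_in_knots:
  assumes "\<phi> \<in> knots"
  shows "segment u \<phi> (shift \<phi>) \<in> knots"
proof -
  obtain q where q: "finite {i. q i \<noteq> 0}" "embedded q" "\<phi> = family q"
    using assms unfolding knots_iff by blast
  show ?thesis
    unfolding q(3) shift_family segment_family
    by (intro family_in_knots finite_segment_poly finite_shift_poly embedded_segment_shift q)
qed

lemma segment_line_in_knots:
  assumes "\<phi> \<in> knots"
  shows "segment u (shift \<phi>) (family line_poly) \<in> knots"
proof -
  obtain q where q: "finite {i. q i \<noteq> 0}" "embedded q" "\<phi> = family q"
    using assms unfolding knots_iff by blast
  show ?thesis
    unfolding q(3) shift_family segment_family
    by (intro family_in_knots finite_segment_poly finite_shift_poly finite_line_poly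
        embedded_segment_line q)
qed

section \<open>Topologies generated by seminorms\<close>

text \<open>Knots do not form a vector space. Their differences lie in the space of finitely
  supported families, and it is there that the seminorms are evaluated; values outside
  \<open>Lam\<close> are ignored.\<close>

definition finsupp :: "(nat \<times> nat \<Rightarrow> real) \<Rightarrow> bool" where
  "finsupp v \<longleftrightarrow> finite {p \<in> Lam. v p \<noteq> 0}"

lemma finsupp_add: "finsupp u \<Longrightarrow> finsupp v \<Longrightarrow> finsupp (\<lambda>p. u p + v p)"
  unfolding finsupp_def
  by (rule finite_subset[of _ "{p \<in> Lam. u p \<noteq> 0} \<union> {p \<in> Lam. v p \<noteq> 0}"]) auto

lemma finsupp_scale: "finsupp v \<Longrightarrow> finsupp (\<lambda>p. c * v p)"
  unfolding finsupp_def by (rule finite_subset[of _ "{p \<in> Lam. v p \<noteq> 0}"]) auto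

lemma finsupp_diff: "\<phi> \<in> knots \<Longrightarrow> \<psi> \<in> knots \<Longrightarrow> finsupp (\<lambda>p. \<phi> p - \<psi> p)"
  using knots_diff_support[of \<phi> \<psi>] by (simp add: finsupp_def)

text \<open>Homogeneity as an inequality is enough, since scaling back by the inverse gives
  equality. The last clause makes \<open>N\<close> blind to values outside \<open>Lam\<close>, where
  pointwise sums and differences of extensional families need not be
  \<open>undefined\<close>.\<close>

definition seminorm :: "((nat \<times> nat \<Rightarrow> real) \<Rightarrow> real) \<Rightarrow> bool" where
  "seminorm N \<longleftrightarrow>
     (\<forall>u v. finsupp u \<longrightarrow> finsupp v \<longrightarrow> N (\<lambda>p. u p + v p) \<le> N u + N v) \<and>
     (\<forall>c v. finsupp v \<longrightarrow> N (\<lambda>p. c * v p) \<le> \<bar>c\<bar> * N v) \<and>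
     (\<forall>u v. (\<forall>p\<in>Lam. u p = v p) \<longrightarrow> N u = N v)"

definition knot_ball ::
    "((nat \<times> nat \<Rightarrow> real) \<Rightarrow> real) \<Rightarrow> (nat \<times> nat \<Rightarrow> real) \<Rightarrow> real \<Rightarrow> (nat \<times> nat \<Rightarrow> real) set" where
  "knot_ball N \<phi> e = {\<psi> \<in> knots. N (\<lambda>p. \<psi> p - \<phi> p) < e}"

text \<open>Balls of single seminorms form neighbourhood bases, so no finite intersections have to
  be handled. The last assumption is continuity of the linear map \<open>shift\<close>, with a
  possible change of seminorm.\<close>

locale seminorm_topology =
  fixes X :: "(nat \<times> nat \<Rightarrow> real) topology"
    and S :: "((nat \<times> nat \<Rightarrow> real) \<Rightarrow> real) set"
  assumes topspace: "topspace X = knots"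
    and seminorm: "N \<in> S \<Longrightarrow> seminorm N"
    and openin_ball: "N \<in> S \<Longrightarrow> \<phi> \<in> knots \<Longrightarrow> e > 0 \<Longrightarrow> openin X (knot_ball N \<phi> e)"
    and ball_subset: "openin X U \<Longrightarrow> \<phi> \<in> U \<Longrightarrow> \<exists>N\<in>S. \<exists>e>0. knot_ball N \<phi> e \<subseteq> U"
    and shift_bound: "N \<in> S \<Longrightarrow> \<exists>M\<in>S. \<forall>v. finsupp v \<longrightarrow> N (shift v) \<le> M v"
begin

lemma add: "N \<in> S \<Longrightarrow> finsupp u \<Longrightarrow> finsupp v \<Longrightarrow> N (\<lambda>p. u p + v p) \<le> N u + N v"
  using seminorm unfolding seminorm_def by blast

lemma scale: "N \<in> S \<Longrightarrow> finsupp v \<Longrightarrow> N (\<lambda>p. c * v p) \<le> \<bar>c\<bar> * N v"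
  using seminorm unfolding seminorm_def by blast

lemma cong: "N \<in> S \<Longrightarrow> (\<And>p. p \<in> Lam \<Longrightarrow> u p = v p) \<Longrightarrow> N u = N v"
  using seminorm unfolding seminorm_def by blast

lemma centre_in_ball:
  assumes "N \<in> S" "\<phi> \<in> knots" "e > 0"
  shows "\<phi> \<in> knot_ball N \<phi> e"
  using scale[OF assms(1), of "\<lambda>_. 0" 0] assms by (simp add: knot_ball_def finsupp_def)

text \<open>On \<open>Lam\<close> the difference of two shifts is the shift of the difference, so
  \<open>shift\<close> sends an \<open>M\<close>-ball into the \<open>N\<close>-ball of the same
  radius.\<close>

lemma continuous_shift: "continuous_map X X shift"
  unfolding continuous_map_def
proof (intro conjI allI impI)
  show "shift \<in> topspace X \<rightarrow> topspace X"
    using shift_in_knots by (auto simp: topspace)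
next
  fix U assume U: "openin X U"
  show "openin X {\<phi> \<in> topspace X. shift \<phi> \<in> U}"
  proof (subst openin_subopen, safe)
    fix \<phi> assume \<phi>: "\<phi> \<in> topspace X" "shift \<phi> \<in> U"
    then obtain N e where N: "N \<in> S" "e > 0" "knot_ball N (shift \<phi>) e \<subseteq> U"
      using ball_subset U by blast
    then obtain M where M: "M \<in> S" "\<And>v. finsupp v \<Longrightarrow> N (shift v) \<le> M v"
      using shift_bound by blast
    have "shift \<psi> \<in> U" if \<psi>: "\<psi> \<in> knot_ball M \<phi> e" for \<psi>
    proof -
      have k: "\<phi> \<in> knots" "\<psi> \<in> knots" using \<phi> \<psi> by (auto simp: topspace knot_ball_def)
      have "N (\<lambda>p. shift \<psi> p - shift \<phi> p) = N (shift (\<lambda>p. \<psi> p - \<phi> p))"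
        by (rule cong[OF N(1)]) (auto simp: shift_def)
      also have "\<dots> \<le> M (\<lambda>p. \<psi> p - \<phi> p)"
        by (rule M(2)[OF finsupp_diff[OF k(2,1)]])
      also have "\<dots> < e" using \<psi> by (simp add: knot_ball_def)
      finally show ?thesis using N(3) shift_in_knots[OF k(2)] by (auto simp: knot_ball_def)
    qed
    moreover have "\<phi> \<in> knot_ball M \<phi> e" "openin X (knot_ball M \<phi> e)"
      using centre_in_ball openin_ball M(1) N(2) \<phi>(1) by (auto simp: topspace)
    moreover have "knot_ball M \<phi> e \<subseteq> topspace X" by (auto simp: knot_ball_def topspace)
    ultimately show "\<exists>T. openin X T \<and> \<phi> \<in> T \<and> T \<subseteq> {\<phi> \<in> topspace X. shift \<phi> \<in> U}"
      by blast
  qed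
qed

text \<open>The difference splits into
  \<open>(1 - u) * (a' - a) + u * (b' - b) + (w - u) * (a - b)\<close>. The first two terms
  contribute a convex combination of quantities below \<open>e / 3\<close>, the third is controlled
  by the last hypothesis.\<close>

lemma segment_estimate:
  assumes N: "N \<in> S" and u: "u \<in> {0..1}" and e: "e > 0"
    and k: "a \<in> knots" "b \<in> knots" "a' \<in> knots" "b' \<in> knots"
    and a: "N (\<lambda>p. a' p - a p) < e / 3" and b: "N (\<lambda>p. b' p - b p) < e / 3"
    and w: "\<bar>w - u\<bar> * N (\<lambda>p. a p - b p) < e / 3"
  shows "N (\<lambda>p. segment u a' b' p - segment w a b p) < e"
proof -
  let ?a = "\<lambda>p. (1 - u) * (a' p - a p)" and ?b = "\<lambda>p. u * (b' p - b p)"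
    and ?c = "\<lambda>p. (w - u) * (a p - b p)"
  have fs: "finsupp ?a" "finsupp ?b" "finsupp ?c"
    using k finsupp_diff finsupp_scale by auto
  have "N (\<lambda>p. segment u a' b' p - segment w a b p) = N (\<lambda>p. ?a p + ?b p + ?c p)"
    by (rule cong[OF N]) (auto simp: segment_def algebra_simps)
  also have "\<dots> \<le> N (\<lambda>p. ?a p + ?b p) + N ?c"
    by (rule add[OF N]) (use fs finsupp_add in auto)
  also have "\<dots> \<le> N ?a + N ?b + N ?c"
    using add[OF N fs(1,2)] by simp
  also have "\<dots> \<le> (1 - u) * N (\<lambda>p. a' p - a p) + u * N (\<lambda>p. b' p - b p)
      + \<bar>w - u\<bar> * N (\<lambda>p. a p - b p)"
    using scale[OF N finsupp_diff[OF k(3,1)], of "1 - u"]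
      scale[OF N finsupp_diff[OF k(4,2)], of u] scale[OF N finsupp_diff[OF k(1,2)], of "w - u"] u
    by simp
  also have "\<dots> < (1 - u) * (e / 3) + u * (e / 3) + e / 3"
    using mult_left_mono[of "N (\<lambda>p. a' p - a p)" "e / 3" "1 - u"]
      mult_left_mono[of "N (\<lambda>p. b' p - b p)" "e / 3" u] a b u w by simp
  also have "\<dots> = 2 / 3 * e" by (simp add: field_simps)
  also have "\<dots> \<le> e" using e by simp
  finally show ?thesis .
qed

text \<open>Joint continuity is checked at each pair of a parameter and a knot: preimages of balls
  of radius \<open>e / 3\<close> under \<open>f\<close> and \<open>g\<close>, together with a short
  parameter interval, meet the hypotheses of \<open>segment_estimate\<close>.\<close>

lemma homotopic_segment:
  assumes f: "continuous_map X X f" and g: "continuous_map X X g"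
    and seg: "\<And>u \<phi>. \<phi> \<in> knots \<Longrightarrow> segment u (f \<phi>) (g \<phi>) \<in> knots"
  shows "homotopic_with (\<lambda>_. True) X X f g"
proof -
  define h where "h = (\<lambda>(u, \<phi>). segment u (f \<phi>) (g \<phi>))"
  have fk: "f \<phi> \<in> knots" and gk: "g \<phi> \<in> knots" if "\<phi> \<in> knots" for \<phi>
    using f g that by (auto simp: continuous_map_def topspace)
  have "continuous_map (prod_topology (top_of_set {0..1}) X) X h"
    unfolding continuous_map_def
  proof (intro conjI allI impI)
    show "h \<in> topspace (prod_topology (top_of_set {0..1}) X) \<rightarrow> topspace X"
      using seg by (auto simp: h_def topspace)
  next
    fix U assume U: "openin X U"
    let ?P = "{x \<in> topspace (prod_topology (top_of_set {0..1}) X). h x \<in> U}"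
    show "openin (prod_topology (top_of_set {0..1}) X) ?P"
      unfolding openin_prod_topology_alt
    proof (intro allI impI)
      fix w \<phi> assume "(w, \<phi>) \<in> ?P"
      hence w: "w \<in> {0..1}" and \<phi>: "\<phi> \<in> knots" and hU: "segment w (f \<phi>) (g \<phi>) \<in> U"
        by (auto simp: topspace h_def)
      obtain N e where N: "N \<in> S" and e: "e > 0" and NU: "knot_ball N (segment w (f \<phi>) (g \<phi>)) e \<subseteq> U"
        using ball_subset[OF U hU] by blast
      let ?K = "\<bar>N (\<lambda>p. f \<phi> p - g \<phi> p)\<bar>"
      \<comment> \<open>This makes \<open>d * ?K\<close> smaller than \<open>e / 3\<close>. Adding 1
        keeps the denominator positive; the absolute value in \<open>?K\<close> avoids an appeal to
        nonnegativity of \<open>N\<close>.\<close>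
      define d where "d = e / (3 * (?K + 1))"
      have d: "d > 0" using e by (simp add: d_def)
      let ?A = "{0..1} \<inter> ball w d"
      let ?B = "{\<psi> \<in> topspace X. f \<psi> \<in> knot_ball N (f \<phi>) (e / 3)}
          \<inter> {\<psi> \<in> topspace X. g \<psi> \<in> knot_ball N (g \<phi>) (e / 3)}"
      have "openin (top_of_set {0..1}) ?A" by (rule openin_open_Int) simp
      moreover have "openin X ?B"
        using f g openin_ball[OF N] fk[OF \<phi>] gk[OF \<phi>] e
        by (intro openin_Int openin_continuous_map_preimage[where Y = X]) auto
      moreover have "w \<in> ?A" using w d by simp
      moreover have "\<phi> \<in> ?B"
        using centre_in_ball[OF N] fk[OF \<phi>] gk[OF \<phi>] e \<phi> by (simp add: topspace)
      moreover have "?A \<times> ?B \<subseteq> ?P"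
      proof (clarify, intro CollectI conjI)
        fix u \<psi>
        assume u: "u \<in> {0..1}" "u \<in> ball w d" and \<psi>: "\<psi> \<in> topspace X"
          and fg: "f \<psi> \<in> knot_ball N (f \<phi>) (e / 3)" "g \<psi> \<in> knot_ball N (g \<phi>) (e / 3)"
        show "(u, \<psi>) \<in> topspace (prod_topology (top_of_set {0..1}) X)" using u \<psi> by simp
        have \<psi>k: "\<psi> \<in> knots" using \<psi> by (simp add: topspace)
        have "\<bar>w - u\<bar> * N (\<lambda>p. f \<phi> p - g \<phi> p) \<le> \<bar>w - u\<bar> * ?K" by (intro mult_left_mono) auto
        also have "\<dots> \<le> d * ?K" using u by (intro mult_right_mono) (auto simp: dist_real_def)
        also have "\<dots> < d * (?K + 1)" using d by simp
        also have "\<dots> = e / 3" by (simp add: d_def divide_simps add_nonneg_eq_0_iff)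
        finally have uw: "\<bar>w - u\<bar> * N (\<lambda>p. f \<phi> p - g \<phi> p) < e / 3" .
        have "N (\<lambda>p. segment u (f \<psi>) (g \<psi>) p - segment w (f \<phi>) (g \<phi>) p) < e"
          by (rule segment_estimate[OF N u(1) e fk[OF \<phi>] gk[OF \<phi>] fk[OF \<psi>k] gk[OF \<psi>k] _ _ uw])
            (use fg in \<open>simp_all add: knot_ball_def\<close>)
        thus "h (u, \<psi>) \<in> U"
          using NU seg[OF \<psi>k, of u] by (auto simp: knot_ball_def h_def)
      qed
      ultimately show "\<exists>A B. openin (top_of_set {0..1}) A \<and> openin X B \<and> w \<in> A \<and> \<phi> \<in> B \<and> A \<times> B \<subseteq> ?P"
        by blast
    qed
  qed
  moreover have "\<forall>x\<in>topspace X. h (0, x) = f x" "\<forall>x\<in>topspace X. h (1, x) = g x"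
    using fk gk segment_0 segment_1 by (auto simp: h_def topspace)
  ultimately show ?thesis by (subst homotopic_with) auto
qed

theorem contractible: "contractible_space X"
proof -
  have line: "continuous_map X X (\<lambda>_. family line_poly)"
    using line_in_knots by (simp add: topspace)
  have "homotopic_with (\<lambda>_. True) X X id shift"
    by (rule homotopic_segment) (auto simp: continuous_shift segment_shift_in_knots)
  moreover have "homotopic_with (\<lambda>_. True) X X shift (\<lambda>_. family line_poly)"
    by (rule homotopic_segment[OF continuous_shift line segment_line_in_knots])
  ultimately show ?thesis
    unfolding contractible_space_def using homotopic_with_trans by blast
qed

end

section \<open>Weighted suprema\<close>

definition wsup :: "(nat \<times> nat \<Rightarrow> real) \<Rightarrow> (nat \<times> nat \<Rightarrow> real) \<Rightarrow> real" where
  "wsup w v = (SUP p\<in>Lam. w p * \<bar>v p\<bar>)"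

text \<open>Component \<open>i\<close> of a family becomes component \<open>Suc i\<close> of its
  shift, so it has to carry the weight of that later position.\<close>

definition shift_weight :: "(nat \<times> nat \<Rightarrow> real) \<Rightarrow> nat \<times> nat \<Rightarrow> real" where
  "shift_weight w = (\<lambda>(i, j). w (Suc i, j))"

lemma finite_wsup_image:
  assumes "finsupp v"
  shows "finite ((\<lambda>p. w p * \<bar>v p\<bar>) ` Lam)"
proof -
  have "(\<lambda>p. w p * \<bar>v p\<bar>) ` Lam \<subseteq> insert 0 ((\<lambda>p. w p * \<bar>v p\<bar>) ` {p \<in> Lam. v p \<noteq> 0})"
    by auto
  thus ?thesis by (rule finite_subset) (use assms in \<open>simp add: finsupp_def\<close>)
qed

lemma wsup_upper: "finsupp v \<Longrightarrow> p \<in> Lam \<Longrightarrow> w p * \<bar>v p\<bar> \<le> wsup w v"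
  unfolding wsup_def by (intro cSUP_upper bdd_above_finite finite_wsup_image)

lemma wsup_least: "(\<And>p. p \<in> Lam \<Longrightarrow> w p * \<bar>v p\<bar> \<le> c) \<Longrightarrow> wsup w v \<le> c"
  unfolding wsup_def by (rule cSUP_least[OF Lam_ne])

text \<open>Finite support leaves only finitely many values, so the supremum is a maximum and strict
  inequalities pass to it.\<close>

lemma wsup_less_iff:
  assumes "finsupp v"
  shows "wsup w v < e \<longleftrightarrow> (\<forall>p\<in>Lam. w p * \<bar>v p\<bar> < e)"
  unfolding wsup_def using finite_wsup_image[OF assms] Lam_ne
  by (subst cSup_eq_Max) auto

lemma seminorm_wsup:
  assumes w: "\<And>p. w p \<ge> 0"
  shows "seminorm (wsup w)"
  unfolding seminorm_def
proof (intro conjI allI impI)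
  fix u v assume uv: "finsupp u" "finsupp v"
  show "wsup w (\<lambda>p. u p + v p) \<le> wsup w u + wsup w v"
  proof (rule wsup_least)
    fix p assume p: "p \<in> Lam"
    have "w p * \<bar>u p + v p\<bar> \<le> w p * \<bar>u p\<bar> + w p * \<bar>v p\<bar>"
      using mult_left_mono[OF abs_triangle_ineq w] by (simp add: distrib_left)
    also have "\<dots> \<le> wsup w u + wsup w v" using wsup_upper uv p by (intro add_mono)
    finally show "w p * \<bar>u p + v p\<bar> \<le> wsup w u + wsup w v" .
  qed
next
  fix c v assume v: "finsupp v"
  show "wsup w (\<lambda>p. c * v p) \<le> \<bar>c\<bar> * wsup w v"
  proof (rule wsup_least)
    fix p assume "p \<in> Lam"
    thus "w p * \<bar>c * v p\<bar> \<le> \<bar>c\<bar> * wsup w v"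
      using mult_left_mono[OF wsup_upper[OF v], of p "\<bar>c\<bar>" w] by (simp add: abs_mult mult.left_commute)
  qed
next
  fix u v :: "nat \<times> nat \<Rightarrow> real" assume "\<forall>p\<in>Lam. u p = v p"
  thus "wsup w u = wsup w v" unfolding wsup_def by (intro SUP_cong) auto
qed

text \<open>The new first component is zero and is dominated because weights are nonnegative; every
  other component is a reindexed component of \<open>v\<close>.\<close>

lemma wsup_shift:
  assumes "\<And>p. w p \<ge> 0" "finsupp v"
  shows "wsup w (shift v) \<le> wsup (shift_weight w) v"
proof (rule wsup_least)
  fix p assume p: "p \<in> Lam"
  obtain i j where ij: "p = (i, j)" by (cases p)
  show "w p * \<bar>shift v p\<bar> \<le> wsup (shift_weight w) v"
  proof (cases "i = 1")
    case True
    have "0 \<le> shift_weight w p * \<bar>v p\<bar>" using assms(1) by (simp add: shift_weight_def ij)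
    also have "\<dots> \<le> wsup (shift_weight w) v" by (rule wsup_upper[OF assms(2) p])
    finally show ?thesis using True p by (simp add: shift_def ij)
  next
    case False
    hence "i > 1" "(i - 1, j) \<in> Lam" using p by (auto simp: Lam_def ij)
    thus ?thesis
      using wsup_upper[OF assms(2), of "(i - 1, j)" "shift_weight w"] p
      by (simp add: shift_weight_def shift_def ij)
  qed
qed

text \<open>Reduces the locale to conditions on a set of weights: closure under
  \<open>shift_weight\<close> supplies the seminorm that bounds the shift.\<close>

lemma contractible_weighted:
  assumes "topspace X = knots" and w: "\<And>w p. w \<in> W \<Longrightarrow> w p \<ge> 0"
    and shift: "\<And>w. w \<in> W \<Longrightarrow> shift_weight w \<in> W"
    and "\<And>w \<phi> e. w \<in> W \<Longrightarrow> \<phi> \<in> knots \<Longrightarrow> e > 0 \<Longrightarrow> openin X (knot_ball (wsup w) \<phi> e)"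
    and "\<And>U \<phi>. openin X U \<Longrightarrow> \<phi> \<in> U \<Longrightarrow> \<exists>w\<in>W. \<exists>e>0. knot_ball (wsup w) \<phi> e \<subseteq> U"
  shows "contractible_space X"
proof (rule seminorm_topology.contractible)
  show "seminorm_topology X (wsup ` W)"
  proof
    fix N assume "N \<in> wsup ` W"
    thus "\<exists>M\<in>wsup ` W. \<forall>v. finsupp v \<longrightarrow> N (shift v) \<le> M v"
      using wsup_shift w shift by blast
  qed (use assms seminorm_wsup in \<open>auto simp: bex_simps\<close>)
qed

text \<open>The link to box and product topologies: since the supremum is attained, a ball is the
  trace on \<open>knots\<close> of a product of intervals.\<close>

lemma knot_ball_wsup:
  assumes "\<phi> \<in> knots"
  shows "knot_ball (wsup w) \<phi> e = knots \<inter> (\<Pi>\<^sub>E p\<in>Lam. {x. w p * \<bar>x - \<phi> p\<bar> < e})"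
  using assms knots_ext
  by (auto simp: knot_ball_def wsup_less_iff finsupp_diff PiE_iff extensional_def)

text \<open>Serves intersections of neighbourhoods: the maximum of two weights gives a ball inside
  both balls.\<close>

lemma knot_ball_antimono:
  assumes "\<phi> \<in> knots" "\<And>p. v p \<le> w p"
  shows "knot_ball (wsup w) \<phi> e \<subseteq> knot_ball (wsup v) \<phi> e"
proof -
  have "wsup v u \<le> wsup w u" if "finsupp u" for u
    using wsup_upper[OF that] assms(2) mult_right_mono[OF assms(2) abs_ge_zero]
    by (intro wsup_least) (meson order_trans)
  thus ?thesis using assms(1) finsupp_diff by (fastforce simp: knot_ball_def)
qed

lemma open_weighted_interval: "open {x::real. c * \<bar>x - a\<bar> < e}"
  by (intro open_Collect_less continuous_intros)

text \<open>In a box, the weight is the inverse of the radius of an interval inside the given open set.\<close>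

lemma weight_for_open:
  fixes A :: "real set"
  assumes "open A" "a \<in> A"
  shows "\<exists>c>0. \<forall>x. c * \<bar>x - a\<bar> < 1 \<longrightarrow> x \<in> A"
proof -
  obtain d where d: "d > 0" "\<And>x. \<bar>x - a\<bar> < d \<Longrightarrow> x \<in> A"
    using assms unfolding open_dist dist_real_def by blast
  show ?thesis
    using d by (intro exI[of _ "1 / d"]) (auto simp: field_simps)
qed

lemma knots_subset_PiE: "knots \<subseteq> Lam \<rightarrow>\<^sub>E UNIV"
  using knots_ext by (auto simp: PiE_iff extensional_def)

section \<open>The box topology\<close>

lemma box_nhd_contains_ball:
  assumes "openin (box_topology (\<lambda>_. euclideanreal) Lam) U" "\<phi> \<in> U" "\<phi> \<in> knots"
  shows "\<exists>w\<in>{w. \<forall>p. w p > 0}. knot_ball (wsup w) \<phi> 1 \<subseteq> U"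
proof -
  \<comment> \<open>Induction on the generation of \<open>U\<close> from boxes. The radius stays 1
    throughout, because weights absorb all scaling.\<close>
  have "generate_topology_on {(\<Pi>\<^sub>E i\<in>Lam. X i) | X. \<forall>i. openin euclideanreal (X i)} U"
    using assms(1) by (simp add: box_topology_def openin_topology_generated_by_iff)
  thus ?thesis using assms(2)
  proof induction
    case Empty
    thus ?case by simp
  next
    case (Int A B)
    then obtain v w where v: "\<forall>p. v p > 0" "knot_ball (wsup v) \<phi> 1 \<subseteq> A"
      and w: "\<forall>p. w p > 0" "knot_ball (wsup w) \<phi> 1 \<subseteq> B" by blast
    have "knot_ball (wsup (\<lambda>p. max (v p) (w p))) \<phi> 1 \<subseteq>
        knot_ball (wsup v) \<phi> 1 \<inter> knot_ball (wsup w) \<phi> 1"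
      by (intro Int_greatest knot_ball_antimono assms(3)) auto
    thus ?case
      using v w by (intro bexI[of _ "\<lambda>p. max (v p) (w p)"]) (auto simp: less_max_iff_disj)
  next
    case (UN K)
    thus ?case by blast
  next
    case (Basis A)
    then obtain Y where Y: "A = (\<Pi>\<^sub>E i\<in>Lam. Y i)" "\<And>i. open (Y i)" by auto
    \<comment> \<open>Each coordinate gets its own weight. Off \<open>Lam\<close> the value 1 serves
      as a default, so that choice yields a weight that is positive everywhere.\<close>
    have "\<exists>c>0. \<forall>x. p \<in> Lam \<longrightarrow> c * \<bar>x - \<phi> p\<bar> < 1 \<longrightarrow> x \<in> Y p" for p
    proof (cases "p \<in> Lam")
      case True
      thus ?thesis using weight_for_open[OF Y(2), of "\<phi> p" p] Basis(2) Y(1) by auto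
    qed (auto intro: exI[of _ 1])
    then obtain w where w: "\<And>p. w p > 0"
      "\<And>p x. p \<in> Lam \<Longrightarrow> w p * \<bar>x - \<phi> p\<bar> < 1 \<Longrightarrow> x \<in> Y p" by metis
    have "knot_ball (wsup w) \<phi> 1 \<subseteq> A"
      unfolding knot_ball_wsup[OF assms(3)] Y(1) using w(2) by (auto simp: PiE_iff)
    thus ?case using w(1) by blast
  qed
qed

lemma contractible_knots_box: "contractible_space knots_box"
proof (rule contractible_weighted[where W = "{w. \<forall>p. w p > 0}"])
  have basis: "openin (box_topology (\<lambda>_. euclideanreal) Lam) (\<Pi>\<^sub>E i\<in>Lam. Y i)"
    if "\<And>i. open (Y i)" for Y
    unfolding box_topology_def using that by (intro topology_generated_by_Basis) auto
  show "topspace knots_box = knots"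
    \<comment> \<open>The box with all factors \<open>UNIV\<close> is open, so every extensional
      family belongs to the underlying space.\<close>
    using openin_subset[OF basis[of "\<lambda>_. UNIV"]] knots_subset_PiE
    by (auto simp: knots_box_def topspace_subtopology)
  fix w \<phi> and e :: real
  assume "\<phi> \<in> knots"
  show "openin knots_box (knot_ball (wsup w) \<phi> e)"
    unfolding knots_box_def knot_ball_wsup[OF \<open>\<phi> \<in> knots\<close>] Int_commute[of knots]
    by (intro openin_subtopology_Int basis open_weighted_interval)
next
  fix U \<phi> assume "openin knots_box U" "\<phi> \<in> U"
  then obtain V where V: "openin (box_topology (\<lambda>_. euclideanreal) Lam) V" "U = V \<inter> knots"
    by (auto simp: knots_box_def openin_subtopology)
  obtain w where "w \<in> {w. \<forall>p. w p > 0}" "knot_ball (wsup w) \<phi> 1 \<subseteq> V"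
    using box_nhd_contains_ball[OF V(1)] V(2) \<open>\<phi> \<in> U\<close> by blast
  moreover have "knot_ball (wsup w) \<phi> 1 \<subseteq> knots" by (auto simp: knot_ball_def)
  ultimately show "\<exists>w\<in>{w. \<forall>p. w p > 0}. \<exists>e>0. knot_ball (wsup w) \<phi> e \<subseteq> U"
    using V(2) zero_less_one by blast
qed (auto simp: shift_weight_def less_imp_le)

section \<open>The product topology\<close>

lemma finite_shift_weight:
  assumes "finite {p \<in> Lam. w p \<noteq> 0}"
  shows "finite {p \<in> Lam. shift_weight w p \<noteq> 0}"
proof (rule finite_subset[of _ "(\<lambda>(i, j). (i - 1, j)) ` {p \<in> Lam. w p \<noteq> 0}"])
  show "{p \<in> Lam. shift_weight w p \<noteq> 0} \<subseteq> (\<lambda>(i, j). (i - 1, j)) ` {p \<in> Lam. w p \<noteq> 0}"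
  proof
    fix p assume p: "p \<in> {p \<in> Lam. shift_weight w p \<noteq> 0}"
    obtain i j where "p = (i, j)" by (cases p)
    thus "p \<in> (\<lambda>(i, j). (i - 1, j)) ` {p \<in> Lam. w p \<noteq> 0}"
      using p by (intro image_eqI[of _ _ "(Suc i, j)"]) (auto simp: Lam_def shift_weight_def)
  qed
qed (use assms in simp)

lemma contractible_knots_prod: "contractible_space knots_prod"
proof (rule contractible_weighted[where W = "{w. (\<forall>p. w p \<ge> 0) \<and> finite {p \<in> Lam. w p \<noteq> 0}}"])
  show "topspace knots_prod = knots"
    using knots_subset_PiE by (auto simp: knots_prod_def topspace_subtopology)
  fix w :: "nat \<times> nat \<Rightarrow> real" and \<phi> and e :: real
  assume w: "w \<in> {w. (\<forall>p. w p \<ge> 0) \<and> finite {p \<in> Lam. w p \<noteq> 0}}" and "\<phi> \<in> knots" "e > 0"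
  \<comment> \<open>Where the weight is zero the condition reads \<open>0 < e\<close>, so only
    finitely many coordinates are constrained and the product of intervals is a basic open
    set.\<close>
  have "{p \<in> Lam. {x. w p * \<bar>x - \<phi> p\<bar> < e} \<noteq> UNIV} \<subseteq> {p \<in> Lam. w p \<noteq> 0}"
    using \<open>e > 0\<close> by auto
  hence "finite {p \<in> Lam. {x. w p * \<bar>x - \<phi> p\<bar> < e} \<noteq> UNIV}"
    by (rule finite_subset) (use w in simp)
  hence "openin (product_topology (\<lambda>_. euclideanreal) Lam)
      (\<Pi>\<^sub>E p\<in>Lam. {x. w p * \<bar>x - \<phi> p\<bar> < e})"
    by (simp add: openin_PiE_gen open_weighted_interval)
  thus "openin knots_prod (knot_ball (wsup w) \<phi> e)"
    unfolding knots_prod_def knot_ball_wsup[OF \<open>\<phi> \<in> knots\<close>] Int_commute[of knots]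
    by (rule openin_subtopology_Int)
next
  fix U \<phi> assume "openin knots_prod U" and \<phi>U: "\<phi> \<in> U"
  then obtain V where V: "openin (product_topology (\<lambda>_. euclideanreal) Lam) V" "U = V \<inter> knots"
    by (auto simp: knots_prod_def openin_subtopology)
  have \<phi>: "\<phi> \<in> knots" "\<phi> \<in> V" using V(2) \<phi>U by auto
  obtain Y where Y: "finite {p \<in> Lam. Y p \<noteq> UNIV}" "\<And>p. p \<in> Lam \<Longrightarrow> open (Y p)"
      "\<phi> \<in> Pi\<^sub>E Lam Y" "Pi\<^sub>E Lam Y \<subseteq> V"
    using V(1) \<phi>(2) unfolding openin_product_topology_alt by auto
  \<comment> \<open>Unconstrained coordinates receive weight 0, which makes the support of the
    weight finite.\<close>
  have "\<exists>c\<ge>0. (Y p = UNIV \<longrightarrow> c = 0) \<and> (\<forall>x. c * \<bar>x - \<phi> p\<bar> < 1 \<longrightarrow> x \<in> Y p)" if "p \<in> Lam" for p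
  proof (cases "Y p = UNIV")
    case False
    thus ?thesis using weight_for_open[OF Y(2), of p "\<phi> p"] Y(3) that by (auto intro: less_imp_le)
  qed auto
  then obtain c where c: "\<And>p. p \<in> Lam \<Longrightarrow> c p \<ge> 0" "\<And>p. p \<in> Lam \<Longrightarrow> Y p = UNIV \<Longrightarrow> c p = 0"
    "\<And>p x. p \<in> Lam \<Longrightarrow> c p * \<bar>x - \<phi> p\<bar> < 1 \<Longrightarrow> x \<in> Y p" by metis
  \<comment> \<open>The chosen \<open>c\<close> is known only on \<open>Lam\<close>; extending it by
    0 makes it nonnegative everywhere.\<close>
  define w where "w = (\<lambda>p. if p \<in> Lam then c p else 0)"
  have "finite {p \<in> Lam. w p \<noteq> 0}"
    by (rule finite_subset[OF _ Y(1)]) (use c(2) in \<open>auto simp: w_def\<close>)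
  moreover have "knot_ball (wsup w) \<phi> 1 \<subseteq> U"
  proof -
    have "(\<Pi>\<^sub>E p\<in>Lam. {x. w p * \<bar>x - \<phi> p\<bar> < 1}) \<subseteq> Pi\<^sub>E Lam Y"
      by (rule PiE_mono) (simp add: w_def c(3) subset_iff)
    thus ?thesis unfolding knot_ball_wsup[OF \<phi>(1)] V(2) using Y(4) by blast
  qed
  ultimately show "\<exists>w\<in>{w. (\<forall>p. w p \<ge> 0) \<and> finite {p \<in> Lam. w p \<noteq> 0}}. \<exists>e>0. knot_ball (wsup w) \<phi> e \<subseteq> U"
    using c(1) by (intro bexI[of _ w] exI[of _ 1]) (auto simp: w_def)
qed (use finite_shift_weight in \<open>auto simp: shift_weight_def\<close>)

section \<open>Metrics\<close>

lemma knot_ball_eq_mball: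
  assumes "Metric_space knots d" "\<And>\<psi>. \<psi> \<in> knots \<Longrightarrow> N (\<lambda>p. \<psi> p - \<phi> p) = d \<psi> \<phi>" "\<phi> \<in> knots"
  shows "knot_ball N \<phi> e = Metric_space.mball knots d \<phi> e"
  using assms Metric_space.commute[OF assms(1)] Metric_space.in_mball[OF assms(1)]
  by (auto simp: knot_ball_def)

text \<open>A single norm suffices here: its balls are the metric balls, and it bounds its own
  composition with the shift.\<close>

lemma contractible_normed:
  assumes d: "Metric_space knots d" and N: "seminorm N"
    and dN: "\<And>\<phi> \<psi>. \<phi> \<in> knots \<Longrightarrow> \<psi> \<in> knots \<Longrightarrow> N (\<lambda>p. \<psi> p - \<phi> p) = d \<psi> \<phi>"
    and shift: "\<And>v. finsupp v \<Longrightarrow> N (shift v) \<le> N v"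
  shows "contractible_space (Metric_space.mtopology knots d)"
proof (rule seminorm_topology.contractible)
  interpret Metric_space knots d by (rule d)
  have ball: "knot_ball N \<phi> e = mball \<phi> e" if "\<phi> \<in> knots" for \<phi> e
    using that dN by (intro knot_ball_eq_mball d)
  show "seminorm_topology mtopology {N}"
  proof
    fix U \<phi> assume "openin mtopology U" "\<phi> \<in> U"
    thus "\<exists>N\<in>{N}. \<exists>e>0. knot_ball N \<phi> e \<subseteq> U"
      using ball unfolding openin_mtopology by (metis singletonI subsetD)
  qed (use N shift ball in auto)
qed

lemma contractible_knots_sup: "contractible_space knots_sup"
  unfolding knots_sup_def
\<comment> \<open>The constant weight 1 gives the supremum norm and is fixed by
  \<open>shift_weight\<close>.\<close>
proof (rule contractible_normed[OF Metric_space_dist_sup, where N = "wsup (\<lambda>_. 1)"])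
  show "seminorm (wsup (\<lambda>_. 1))" by (rule seminorm_wsup) simp
  show "wsup (\<lambda>_. 1) (\<lambda>p. \<psi> p - \<phi> p) = dist_sup \<psi> \<phi>" if "\<phi> \<in> knots" "\<psi> \<in> knots" for \<phi> \<psi>
    using that by (simp add: wsup_def dist_sup_def)
  show "wsup (\<lambda>_. 1) (shift v) \<le> wsup (\<lambda>_. 1) v" if "finsupp v" for v
    using wsup_shift[OF _ that, of "\<lambda>_. 1"] by (simp add: shift_weight_def case_prod_unfold)
qed

text \<open>The l^r norm as distance from the zero family. That family is not a knot, but
  \<open>dist_r\<close> makes sense for all families.\<close>

definition rnorm :: "real \<Rightarrow> (nat \<times> nat \<Rightarrow> real) \<Rightarrow> real" where
  "rnorm r v = dist_r r v (\<lambda>_. 0)"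

lemma rnorm_finite:
  assumes "finite F" "F \<subseteq> Lam" "{p \<in> Lam. v p \<noteq> 0} \<subseteq> F"
  shows "rnorm r v = (\<Sum>p\<in>F. \<bar>v p\<bar> powr r) powr (1 / r)"
  unfolding rnorm_def by (subst dist_r_finite[OF assms]) simp

text \<open>The triangle inequality is Minkowski's on the union of the two supports; for homogeneity
  the factor \<bar>c\<bar> to the power r leaves the finite sum and the root is taken.\<close>

lemma seminorm_rnorm:
  assumes r: "r \<ge> 1"
  shows "seminorm (rnorm r)"
  unfolding seminorm_def
proof (intro conjI allI impI)
  fix u v assume uv: "finsupp u" "finsupp v"
  let ?F = "{p \<in> Lam. u p \<noteq> 0} \<union> {p \<in> Lam. v p \<noteq> 0}"
  have F: "finite ?F" using uv by (simp add: finsupp_def)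
  have "rnorm r (\<lambda>p. u p + v p) = (\<Sum>p\<in>?F. \<bar>u p + v p\<bar> powr r) powr (1 / r)"
    by (rule rnorm_finite[OF F]) auto
  also have "\<dots> \<le> (\<Sum>p\<in>?F. (\<bar>u p\<bar> + \<bar>v p\<bar>) powr r) powr (1 / r)"
    using r by (intro powr_mono2 sum_mono sum_nonneg) auto
  also have "\<dots> \<le> (\<Sum>p\<in>?F. \<bar>u p\<bar> powr r) powr (1 / r) + (\<Sum>p\<in>?F. \<bar>v p\<bar> powr r) powr (1 / r)"
    by (rule Minkowski_finite[OF F r]) auto
  also have "\<dots> = rnorm r u + rnorm r v"
    by (subst (1 2) rnorm_finite[OF F]) auto
  finally show "rnorm r (\<lambda>p. u p + v p) \<le> rnorm r u + rnorm r v" .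
next
  fix c v assume v: "finsupp v"
  let ?F = "{p \<in> Lam. v p \<noteq> 0}"
  have F: "finite ?F" using v by (simp add: finsupp_def)
  have "rnorm r (\<lambda>p. c * v p) = (\<bar>c\<bar> powr r * (\<Sum>p\<in>?F. \<bar>v p\<bar> powr r)) powr (1 / r)"
    by (subst rnorm_finite[OF F]) (auto simp: abs_mult powr_mult sum_distrib_left)
  also have "\<dots> = \<bar>c\<bar> * rnorm r v"
    using r by (subst rnorm_finite[OF F]) (auto simp: powr_mult powr_powr sum_nonneg)
  finally show "rnorm r (\<lambda>p. c * v p) \<le> \<bar>c\<bar> * rnorm r v" by simp
next
  fix u v :: "nat \<times> nat \<Rightarrow> real" assume "\<forall>p\<in>Lam. u p = v p"
  hence "(\<Sum>\<^sub>\<infinity>p\<in>Lam. \<bar>u p - 0\<bar> powr r) = (\<Sum>\<^sub>\<infinity>p\<in>Lam. \<bar>v p - 0\<bar> powr r)"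
    by (intro infsum_cong) auto
  thus "rnorm r u = rnorm r v" by (simp add: rnorm_def dist_r_def)
qed

text \<open>The shift inserts a zero component and moves the support injectively, so the sum of
  powers is only reindexed.\<close>

lemma rnorm_shift:
  assumes "finsupp v"
  shows "rnorm r (shift v) = rnorm r v"
proof -
  let ?F = "{p \<in> Lam. v p \<noteq> 0}" and ?s = "\<lambda>(i, j). (Suc i, j :: nat)"
  have F: "finite ?F" using assms by (simp add: finsupp_def)
  have "{p \<in> Lam. shift v p \<noteq> 0} \<subseteq> ?s ` ?F"
  proof
    fix p assume p: "p \<in> {p \<in> Lam. shift v p \<noteq> 0}"
    obtain i j where "p = (i, j)" by (cases p)
    thus "p \<in> ?s ` ?F"
      using p by (intro image_eqI[of _ _ "(i - 1, j)"]) (auto simp: Lam_def shift_def split: if_splits)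
  qed
  hence "rnorm r (shift v) = (\<Sum>p\<in>?s ` ?F. \<bar>shift v p\<bar> powr r) powr (1 / r)"
    using F by (intro rnorm_finite) (auto simp: Lam_def)
  also have "(\<Sum>p\<in>?s ` ?F. \<bar>shift v p\<bar> powr r) = (\<Sum>p\<in>?F. \<bar>v p\<bar> powr r)"
    by (subst sum.reindex) (auto simp: inj_on_def shift_def Lam_def intro!: sum.cong)
  also have "\<dots> powr (1 / r) = rnorm r v" by (subst rnorm_finite[OF F]) auto
  finally show ?thesis .
qed

lemma contractible_knots_r:
  assumes "r \<ge> 1"
  shows "contractible_space (knots_r r)"
  unfolding knots_r_def
proof (rule contractible_normed[OF Metric_space_dist_r[OF assms] seminorm_rnorm[OF assms]])
  show "rnorm r (\<lambda>p. \<psi> p - \<phi> p) = dist_r r \<psi> \<phi>" for \<phi> \<psi>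
    by (simp add: rnorm_def dist_r_def)
  show "rnorm r (shift v) \<le> rnorm r v" if "finsupp v" for v
    using rnorm_shift[OF that] by simp
qed

theorem theorem4p2:
  shows "contractible_space knots_box \<and> contractible_space knots_prod \<and>
    (\<forall>r::real. r \<ge> 1 \<longrightarrow> contractible_space (knots_r r)) \<and> contractible_space knots_sup"
  using contractible_knots_box contractible_knots_prod contractible_knots_r contractible_knots_sup
  by blast

end
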